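(* The set of (isomorphism types of) weakly connected finite digraphs is first-order definable in the poset $(\mathcal{D};\leq)$.
   Context: A digraph is a pair $G=(V,E)$ with $V$ a nonempty set and $E\subseteq V^2$ (loops allowed). Write $G\leq G'$ if there is an injective homomorphism $G\to G'$, i.e. an injective map of vertex sets sending edges to edges (edges need not be reflected). $\mathcal{D}$ is the set of isomorphism types of finite digraphs; it is partially ordered by $\leq$, and digraphs are identified with their isomorphism types. A digraph is weakly connected if there is no subset $H$ of its vertices, nonempty and with nonempty complement, such that every edge has both endpoints in $H$ or both endpoints outside $H$. First-order definable means definable by a first-order formula in the language of posets, without parameters. *)

theory Defs
  imports "Graph_Theory.Pair_Digraph" "Graph_Theory.Digraph_Isomorphism"
begin

text \<open>Unlike \<^locale>\<open>pair_digraph\<close>, \<^locale>\<open>pair_fin_digraph\<close> allows loops.\<close>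

definition finite_digraph :: "'a pair_pre_digraph \<Rightarrow> bool" where
  "finite_digraph G \<longleftrightarrow> pair_fin_digraph G \<and> pverts G \<noteq> {}"

definition inj_hom :: "('a \<Rightarrow> 'b) \<Rightarrow> 'a pair_pre_digraph \<Rightarrow> 'b pair_pre_digraph \<Rightarrow> bool" where
  "inj_hom f G H \<longleftrightarrow> f ` pverts G \<subseteq> pverts H \<and> inj_on f (pverts G) \<and>
     (\<forall>u v. (u, v) \<in> parcs G \<longrightarrow> (f u, f v) \<in> parcs H)"

definition embeds :: "'a pair_pre_digraph \<Rightarrow> 'b pair_pre_digraph \<Rightarrow> bool" where
  "embeds G H \<longleftrightarrow> (\<exists>f. inj_hom f G H)"

definition weakly_connected :: "'a pair_pre_digraph \<Rightarrow> bool" where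
  "weakly_connected G \<longleftrightarrow>
     \<not> (\<exists>H\<subseteq>pverts G. H \<noteq> {} \<and> pverts G - H \<noteq> {} \<and>
          (\<forall>(u, v)\<in>parcs G. (u \<in> H \<and> v \<in> H) \<or> (u \<notin> H \<and> v \<notin> H)))"

text \<open>The library isomorphisms also carry an arc map; without parallel arcs they amount to
  vertex bijections that preserve and reflect arcs.\<close>

lemma digraph_iso_with_proj_iff:
  assumes "pair_wf_digraph G" "pair_wf_digraph H"
  shows "digraph_iso (with_proj G) (with_proj H) \<longleftrightarrow>
    (\<exists>f. bij_betw f (pverts G) (pverts H) \<and>
      (\<forall>u\<in>pverts G. \<forall>v\<in>pverts G. (u, v) \<in> parcs G \<longleftrightarrow> (f u, f v) \<in> parcs H))"
  (is "?L \<longleftrightarrow> ?R")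
proof
  interpret G: pair_wf_digraph G by fact
  interpret H: pair_wf_digraph H by fact
  assume ?L
  then obtain h where h: "pre_digraph.digraph_isomorphism (with_proj G) h"
    and H: "with_proj H = app_iso h (with_proj G)"
    unfolding digraph_iso_def by blast
  let ?f = "iso_verts h" and ?g = "iso_arcs h"
  have V: "pverts H = ?f ` pverts G" and A: "parcs H = ?g ` parcs G"
    and t: "iso_tail h = fst" and hd: "iso_head h = snd"
    using H by (simp_all add: with_proj_def app_iso_def)
  have inj: "inj_on ?f (pverts G)"
    and g: "\<And>e. e \<in> parcs G \<Longrightarrow> ?g e = (?f (fst e), ?f (snd e))"
    using h t hd unfolding G.digraph_isomorphism_def by (auto simp: prod_eq_iff)
  have "(u, v) \<in> parcs G \<longleftrightarrow> (?f u, ?f v) \<in> parcs H" if "u \<in> pverts G" "v \<in> pverts G" for u v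
  proof
    assume "(u, v) \<in> parcs G"
    then show "(?f u, ?f v) \<in> parcs H" using A g by force
  next
    assume "(?f u, ?f v) \<in> parcs H"
    then obtain e where e: "e \<in> parcs G" "?f (fst e) = ?f u" "?f (snd e) = ?f v"
      using A g by force
    then have "fst e = u" "snd e = v"
      using inj that G.arc_fst_in_verts G.arc_snd_in_verts by (auto dest: inj_onD)
    then show "(u, v) \<in> parcs G" using e by auto
  qed
  then show ?R using V inj by (auto simp: bij_betw_def)
next
  interpret G: pair_wf_digraph G by fact
  interpret H: pair_wf_digraph H by fact
  assume ?R
  then obtain f where f: "bij_betw f (pverts G) (pverts H)"
    and a: "\<And>u v. u \<in> pverts G \<Longrightarrow> v \<in> pverts G \<Longrightarrow> (u, v) \<in> parcs G \<longleftrightarrow> (f u, f v) \<in> parcs H"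
    by blast
  let ?h = "\<lparr> iso_verts = f, iso_arcs = map_prod f f, iso_head = snd, iso_tail = fst \<rparr>"
  have inj: "inj_on f (pverts G)" and V: "f ` pverts G = pverts H"
    using f by (auto simp: bij_betw_def)
  have sub: "parcs G \<subseteq> pverts G \<times> pverts G"
    using G.in_arcsD1 G.in_arcsD2 by auto
  have "inj_on (map_prod f f) (parcs G)"
    using inj map_prod_inj_on sub inj_on_subset by blast
  then have 1: "pre_digraph.digraph_isomorphism (with_proj G) ?h"
    unfolding G.digraph_isomorphism_def using inj G.wf_digraph by auto
  have "map_prod f f ` parcs G = parcs H"
  proof (intro equalityI subrelI)
    fix x y assume "(x, y) \<in> map_prod f f ` parcs G"
    then show "(x, y) \<in> parcs H" using a sub by auto
  next
    fix x y assume xy: "(x, y) \<in> parcs H"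
    then obtain u v where "u \<in> pverts G" "v \<in> pverts G" "x = f u" "y = f v"
      using V H.in_arcsD1 H.in_arcsD2 by (metis imageE)
    with xy a show "(x, y) \<in> map_prod f f ` parcs G" by force
  qed
  then have "with_proj H = app_iso ?h (with_proj G)"
    using V by (simp add: with_proj_def app_iso_def)
  with 1 show ?L unfolding digraph_iso_def by blast
qed

definition fin_iso :: "'a pair_pre_digraph \<Rightarrow> 'b pair_pre_digraph \<Rightarrow> bool" where
  "fin_iso G H \<longleftrightarrow> finite_digraph G \<and> finite_digraph H \<and> digraph_iso (with_proj G) (with_proj H)"

lemma finite_digraph_wf: "finite_digraph G \<Longrightarrow> pair_wf_digraph G"
  by (simp add: finite_digraph_def pair_fin_digraph_def)

lemma embeds_refl: "embeds G G"
  unfolding embeds_def inj_hom_def by (rule exI[of _ id]) auto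

lemma inj_hom_comp: "inj_hom f G H \<Longrightarrow> inj_hom g H K \<Longrightarrow> inj_hom (g \<circ> f) G K"
  unfolding inj_hom_def inj_on_def image_subset_iff o_def by meson

lemma embeds_trans: "embeds G H \<Longrightarrow> embeds H K \<Longrightarrow> embeds G K"
  unfolding embeds_def using inj_hom_comp by blast

lemma fin_iso_refl: "finite_digraph G \<Longrightarrow> fin_iso G G"
  unfolding fin_iso_def
  by (auto simp: digraph_iso_with_proj_iff finite_digraph_wf intro!: exI[of _ id])

lemma fin_iso_inverse_homs:
  assumes "fin_iso G H"
  shows "\<exists>f g. inj_hom f G H \<and> inj_hom g H G \<and>
    (\<forall>x\<in>pverts G. g (f x) = x) \<and> (\<forall>y\<in>pverts H. f (g y) = y)"
proof -
  have wf: "pair_wf_digraph G" "pair_wf_digraph H"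
    using assms by (auto simp: fin_iso_def finite_digraph_wf)
  from assms obtain f where f: "bij_betw f (pverts G) (pverts H)"
    and a: "\<And>u v. u \<in> pverts G \<Longrightarrow> v \<in> pverts G \<Longrightarrow> (u, v) \<in> parcs G \<longleftrightarrow> (f u, f v) \<in> parcs H"
    using wf by (auto simp: fin_iso_def digraph_iso_with_proj_iff)
  let ?g = "the_inv_into (pverts G) f"
  have g: "bij_betw ?g (pverts H) (pverts G)"
    using f by (rule bij_betw_the_inv_into)
  have gf: "?g (f x) = x" if "x \<in> pverts G" for x
    using f that by (auto simp: bij_betw_def the_inv_into_f_f)
  have fg: "f (?g y) = y" if "y \<in> pverts H" for y
    using f that by (auto simp: bij_betw_def f_the_inv_into_f)
  have 1: "inj_hom f G H"
    using f a pair_wf_digraph.in_arcsD1[OF wf(1)] pair_wf_digraph.in_arcsD2[OF wf(1)]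
    unfolding inj_hom_def bij_betw_def by blast
  have "(?g u, ?g v) \<in> parcs G" if "(u, v) \<in> parcs H" for u v
  proof -
    have uv: "u \<in> pverts H" "v \<in> pverts H"
      using that pair_wf_digraph.in_arcsD1[OF wf(2)] pair_wf_digraph.in_arcsD2[OF wf(2)] by blast+
    then have "?g u \<in> pverts G" "?g v \<in> pverts G" using g by (auto simp: bij_betw_def)
    then show ?thesis using a fg uv that by metis
  qed
  then have 2: "inj_hom ?g H G"
    using g unfolding inj_hom_def bij_betw_def by blast
  from 1 2 gf fg show ?thesis by blast
qed

lemma fin_isoI:
  assumes "finite_digraph G" "finite_digraph H" "inj_hom f G H" "inj_hom g H G"
    "\<And>x. x \<in> pverts G \<Longrightarrow> g (f x) = x" "\<And>y. y \<in> pverts H \<Longrightarrow> f (g y) = y"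
  shows "fin_iso G H"
proof -
  have "bij_betw f (pverts G) (pverts H)"
    using assms(3-6) unfolding inj_hom_def by (intro bij_betw_byWitness[of _ g]) auto
  moreover have "(u, v) \<in> parcs G \<longleftrightarrow> (f u, f v) \<in> parcs H"
    if "u \<in> pverts G" "v \<in> pverts G" for u v
    using that assms(3-5) unfolding inj_hom_def by metis
  ultimately show ?thesis
    using assms(1,2) unfolding fin_iso_def
    by (auto simp: digraph_iso_with_proj_iff finite_digraph_wf)
qed

lemma fin_iso_sym:
  assumes "fin_iso G H"
  shows "fin_iso H G"
proof -
  obtain f g where fg: "inj_hom f G H" "inj_hom g H G"
    "\<And>x. x \<in> pverts G \<Longrightarrow> g (f x) = x" "\<And>y. y \<in> pverts H \<Longrightarrow> f (g y) = y"
    using fin_iso_inverse_homs[OF assms] by blast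
  show ?thesis
    using assms by (intro fin_isoI[OF _ _ fg(2) fg(1) fg(4) fg(3)]) (auto simp: fin_iso_def)
qed

lemma fin_iso_trans:
  assumes "fin_iso G H" "fin_iso H K"
  shows "fin_iso G K"
proof -
  obtain f g where 1: "inj_hom f G H" "inj_hom g H G"
    "\<And>x. x \<in> pverts G \<Longrightarrow> g (f x) = x" "\<And>y. y \<in> pverts H \<Longrightarrow> f (g y) = y"
    using fin_iso_inverse_homs[OF assms(1)] by blast
  obtain f' g' where 2: "inj_hom f' H K" "inj_hom g' K H"
    "\<And>x. x \<in> pverts H \<Longrightarrow> g' (f' x) = x" "\<And>y. y \<in> pverts K \<Longrightarrow> f' (g' y) = y"
    using fin_iso_inverse_homs[OF assms(2)] by blast
  have "inj_hom (f' \<circ> f) G K" "inj_hom (g \<circ> g') K G"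
    using 1(1,2) 2(1,2) by (simp_all add: inj_hom_comp[of f G H f' K] inj_hom_comp[of g' K H g G])
  moreover have "(g \<circ> g') ((f' \<circ> f) x) = x" if "x \<in> pverts G" for x
    using that 1 2 unfolding inj_hom_def by (simp add: image_subset_iff)
  moreover have "(f' \<circ> f) ((g \<circ> g') y) = y" if "y \<in> pverts K" for y
    using that 1 2 unfolding inj_hom_def by (simp add: image_subset_iff)
  ultimately show ?thesis
    using assms by (intro fin_isoI) (auto simp: fin_iso_def)
qed

lemma fin_iso_embeds: "fin_iso G H \<Longrightarrow> embeds G H"
  using fin_iso_inverse_homs unfolding embeds_def by blast

lemma embeds_antisym:
  assumes "finite_digraph G" "finite_digraph H" "embeds G H" "embeds H G"
  shows "fin_iso G H"
proof -
  interpret G: pair_fin_digraph G using assms(1) by (simp add: finite_digraph_def)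
  interpret H: pair_fin_digraph H using assms(2) by (simp add: finite_digraph_def)
  have subG: "parcs G \<subseteq> pverts G \<times> pverts G" and subH: "parcs H \<subseteq> pverts H \<times> pverts H"
    using G.in_arcsD1 G.in_arcsD2 H.in_arcsD1 H.in_arcsD2 by auto
  obtain f where f: "inj_hom f G H" using assms(3) by (auto simp: embeds_def)
  obtain g where g: "inj_hom g H G" using assms(4) by (auto simp: embeds_def)
  have injf: "inj_on f (pverts G)" and fV: "f ` pverts G \<subseteq> pverts H"
    and fA: "map_prod f f ` parcs G \<subseteq> parcs H"
    using f by (auto simp: inj_hom_def)
  have injg: "inj_on g (pverts H)" and gV: "g ` pverts H \<subseteq> pverts G"
    and gA: "map_prod g g ` parcs H \<subseteq> parcs G"
    using g by (auto simp: inj_hom_def)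
  have injfA: "inj_on (map_prod f f) (parcs G)"
    using map_prod_inj_on[OF injf injf] subG by (rule inj_on_subset)
  have injgA: "inj_on (map_prod g g) (parcs H)"
    using map_prod_inj_on[OF injg injg] subH by (rule inj_on_subset)
  have "f ` pverts G = pverts H"
    using card_inj_on_le[OF injg gV G.pair_finite_verts] card_image[OF injf] fV
    by (intro card_seteq) (auto simp: H.pair_finite_verts)
  moreover have A: "map_prod f f ` parcs G = parcs H"
    using card_inj_on_le[OF injgA gA G.pair_finite_arcs] card_image[OF injfA] fA
    by (intro card_seteq) (auto simp: H.pair_finite_arcs)
  moreover have "(u, v) \<in> parcs G \<longleftrightarrow> (f u, f v) \<in> parcs H"
    if uv: "u \<in> pverts G" "v \<in> pverts G" for u v
  proof
    assume "(u, v) \<in> parcs G" then show "(f u, f v) \<in> parcs H" using f by (auto simp: inj_hom_def)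
  next
    assume "(f u, f v) \<in> parcs H"
    then obtain x y where xy: "(x, y) \<in> parcs G" "f x = f u" "f y = f v"
      using A by force
    then have "x = u" "y = v"
      using injf uv subG by (auto dest: inj_onD)
    then show "(u, v) \<in> parcs G" using xy by simp
  qed
  ultimately show ?thesis
    using assms(1,2) injf unfolding fin_iso_def
    by (auto simp: digraph_iso_with_proj_iff finite_digraph_wf bij_betw_def)
qed

lemma weakly_connected_fin_iso:
  assumes "fin_iso G H" "weakly_connected G"
  shows "weakly_connected H"
proof -
  obtain f g where fg: "inj_hom f G H" "inj_hom g H G"
    "\<And>x. x \<in> pverts G \<Longrightarrow> g (f x) = x" "\<And>y. y \<in> pverts H \<Longrightarrow> f (g y) = y"
    using fin_iso_inverse_homs[OF assms(1)] by blast
  have wf: "pair_wf_digraph G" using assms(1) by (simp add: fin_iso_def finite_digraph_wf)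
  show ?thesis
    unfolding weakly_connected_def
  proof (rule notI, elim bexE exE conjE)
    fix S assume S: "S \<subseteq> pverts H" "S \<noteq> {}" "pverts H - S \<noteq> {}"
      "\<forall>(u, v)\<in>parcs H. (u \<in> S \<and> v \<in> S) \<or> (u \<notin> S \<and> v \<notin> S)"
    let ?T = "{x \<in> pverts G. f x \<in> S}"
    obtain a b where ab: "a \<in> S" "a \<in> pverts H" "b \<in> pverts H" "b \<notin> S" using S by blast
    have "g a \<in> ?T" "g b \<in> pverts G - ?T"
      using ab fg unfolding inj_hom_def by auto
    moreover have "\<forall>(u, v)\<in>parcs G. (u \<in> ?T \<and> v \<in> ?T) \<or> (u \<notin> ?T \<and> v \<notin> ?T)"
    proof clarify
      fix u v assume uv: "(u, v) \<in> parcs G"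
        and n: "\<not> (u \<notin> ?T \<and> v \<notin> ?T)"
      have "(f u, f v) \<in> parcs H" using fg(1) uv by (auto simp: inj_hom_def)
      moreover have "u \<in> pverts G" "v \<in> pverts G"
        using uv pair_wf_digraph.in_arcsD1[OF wf] pair_wf_digraph.in_arcsD2[OF wf] by blast+
      ultimately show "u \<in> ?T \<and> v \<in> ?T" using S(4) n by auto
    qed
    ultimately have "\<exists>T\<subseteq>pverts G. T \<noteq> {} \<and> pverts G - T \<noteq> {} \<and>
        (\<forall>(u, v)\<in>parcs G. (u \<in> T \<and> v \<in> T) \<or> (u \<notin> T \<and> v \<notin> T))"
      by (intro exI[of _ ?T] conjI) auto
    then show False
      using assms(2) unfolding weakly_connected_def by (rule notE[rotated])
  qed
qed

lemma ex_nat_representative: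
  assumes "finite_digraph G"
  shows "\<exists>H :: nat pair_pre_digraph. fin_iso G H"
proof -
  interpret G: pair_fin_digraph G using assms by (simp add: finite_digraph_def)
  obtain f :: "'a \<Rightarrow> nat" where f: "inj_on f (pverts G)"
    using finite_imp_inj_to_nat_seg[OF G.pair_finite_verts] by blast
  let ?H = "\<lparr> pverts = f ` pverts G, parcs = map_prod f f ` parcs G \<rparr>"
  have H: "finite_digraph ?H"
    unfolding finite_digraph_def
  proof
    show "pair_fin_digraph ?H"
      using G.in_arcsD1 G.in_arcsD2 G.pair_finite_verts G.pair_finite_arcs
      by unfold_locales auto
    show "pverts ?H \<noteq> {}" using assms by (simp add: finite_digraph_def)
  qed
  have a: "(u, v) \<in> parcs G" if uv: "u \<in> pverts G" "v \<in> pverts G"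
    and fa: "(f u, f v) \<in> map_prod f f ` parcs G" for u v
  proof -
    obtain x y where xy: "(x, y) \<in> parcs G" "f x = f u" "f y = f v" using fa by force
    have "x = u" using f xy(2) G.in_arcsD1[OF xy(1)] uv(1) by (rule inj_onD)
    moreover have "y = v" using f xy(3) G.in_arcsD2[OF xy(1)] uv(2) by (rule inj_onD)
    ultimately show ?thesis using xy(1) by simp
  qed
  have a': "(f u, f v) \<in> map_prod f f ` parcs G" if "(u, v) \<in> parcs G" for u v
    using that by force
  have "(u, v) \<in> parcs G \<longleftrightarrow> (f u, f v) \<in> parcs ?H"
    if "u \<in> pverts G" "v \<in> pverts G" for u v
    using a[OF that] a' unfolding pair_pre_digraph.simps by (rule iffI[rotated])
  moreover have "bij_betw f (pverts G) (pverts ?H)"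
    using f by (simp add: bij_betw_def)
  ultimately have "digraph_iso (with_proj G) (with_proj ?H)"
    using digraph_iso_with_proj_iff[OF finite_digraph_wf[OF assms] finite_digraph_wf[OF H]] by blast
  then show ?thesis using assms H unfolding fin_iso_def by blast
qed

text \<open>By \<open>ex_nat_representative\<close>, \<^typ>\<open>nat\<close> is a large enough universe of vertices for all isomorphism
  types. The relation \<^const>\<open>fin_iso\<close> is partial: its domain consists of the finite
  nonempty digraphs.\<close>

quotient_type digraph_type = "nat pair_pre_digraph" / partial: "fin_iso"
proof (rule part_equivpI)
  have "finite_digraph \<lparr> pverts = {0::nat}, parcs = {} \<rparr>"
    unfolding finite_digraph_def by (auto intro!: pair_fin_digraph.intro
      pair_wf_digraph.intro pair_fin_digraph_axioms.intro)
  then show "\<exists>G::nat pair_pre_digraph. fin_iso G G" using fin_iso_refl by blast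
  show "symp fin_iso" using fin_iso_sym by (rule sympI)
  show "transp fin_iso" using fin_iso_trans by (rule transpI)
qed

instantiation digraph_type :: order
begin

lift_definition less_eq_digraph_type :: "digraph_type \<Rightarrow> digraph_type \<Rightarrow> bool" is embeds
  by (meson embeds_trans fin_iso_embeds fin_iso_sym)

definition less_digraph_type :: "digraph_type \<Rightarrow> digraph_type \<Rightarrow> bool" where
  "less_digraph_type G H \<longleftrightarrow> G \<le> H \<and> \<not> H \<le> G"

instance
proof
  fix G H K :: digraph_type
  show "G < H \<longleftrightarrow> G \<le> H \<and> \<not> H \<le> G" by (rule less_digraph_type_def)
  show "G \<le> G" by transfer (rule embeds_refl)
  show "G \<le> H \<Longrightarrow> H \<le> K \<Longrightarrow> G \<le> K" by transfer (rule embeds_trans)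
  show "G \<le> H \<Longrightarrow> H \<le> G \<Longrightarrow> G = H"
    by transfer (rule embeds_antisym, auto simp: fin_iso_def)
qed

end

lift_definition weakly_connected_type :: "digraph_type \<Rightarrow> bool" is weakly_connected
  using weakly_connected_fin_iso fin_iso_sym by blast

text \<open>First-order formulas in the language of posets, with variables named by natural numbers.\<close>

datatype fo_formula =
    Equal nat nat
  | LessEq nat nat
  | Neg fo_formula
  | Conj fo_formula fo_formula
  | Exists nat fo_formula

primrec free_vars :: "fo_formula \<Rightarrow> nat set" where
  "free_vars (Equal x y) = {x, y}"
| "free_vars (LessEq x y) = {x, y}"
| "free_vars (Neg \<phi>) = free_vars \<phi>"
| "free_vars (Conj \<phi> \<psi>) = free_vars \<phi> \<union> free_vars \<psi>"
| "free_vars (Exists x \<phi>) = free_vars \<phi> - {x}"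

primrec satisfies :: "(nat \<Rightarrow> 'a::order) \<Rightarrow> fo_formula \<Rightarrow> bool" where
  "satisfies s (Equal x y) \<longleftrightarrow> s x = s y"
| "satisfies s (LessEq x y) \<longleftrightarrow> s x \<le> s y"
| "satisfies s (Neg \<phi>) \<longleftrightarrow> \<not> satisfies s \<phi>"
| "satisfies s (Conj \<phi> \<psi>) \<longleftrightarrow> satisfies s \<phi> \<and> satisfies s \<psi>"
| "satisfies s (Exists x \<phi>) \<longleftrightarrow> (\<exists>a. satisfies (s(x := a)) \<phi>)"

text \<open>The formula has at most one free variable, so the value that the assignment
  below gives to the other variables is irrelevant and no parameters enter.\<close>

definition fo_definable :: "'a::order set \<Rightarrow> bool" where
  "fo_definable S \<longleftrightarrow>
     (\<exists>\<phi> x. free_vars \<phi> \<subseteq> {x} \<and> S = {a. satisfies (\<lambda>_. a) \<phi>})"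

end

theory Submission
  imports Defs
begin

text \<open>A digraph \<open>G\<close> on \<open>n\<close> vertices is disconnected iff it lies below a digraph on \<open>n\<close> vertices
  in which some copy of a complete digraph \<open>K\<^sub>b\<close>, \<open>1 \<le> b < n\<close>, fills a union of weak components. If \<open>G\<close> splits
  into a part of size \<open>b\<close> and one of size \<open>a \<le> b\<close>, then filling both parts gives such a digraph
  \<open>H\<close>, and the choice of the larger part makes this visible from below: any weakly connected
  digraph with \<open>b + 1\<close> vertices is too large for either part of \<open>H\<close>. So no digraph obtained from
  \<open>K\<^sub>b\<close> by attaching one further vertex embeds into \<open>H\<close>. Conversely, if no such digraph embeds
  into some \<open>H\<close> that contains \<open>K\<^sub>b\<close> and has more than \<open>b\<close> vertices, then no arc leaves or enters a
  copy of \<open>K\<^sub>b\<close> in \<open>H\<close>. Hence \<open>H\<close>, and every \<open>G\<close> that embeds into \<open>H\<close> bijectively on vertices, is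
  disconnected. This is \<open>separable\<close> below, and the two directions are \<open>separable_if_not_connected\<close>
  and \<open>not_connected_if_separable\<close>.

  It remains to express the ingredients by the order alone. Above \<open>G\<close> there is always \<open>G\<close> with an
  isolated vertex added, and this is the least strict upper bound of \<open>G\<close> iff no arc can be added
  to \<open>G\<close> (\<open>least_above_imp_full\<close>, \<open>least_above_full\<close>). In the whole order this singles out the
  complete digraphs with all loops. They measure the number of vertices, since \<open>G\<close> embeds into the
  one on \<open>k\<close> vertices iff \<open>G\<close> has at most \<open>k\<close> vertices; the smallest of them is the single loop,
  so they also define looplessness. The same characterization within the loopless digraphs yields
  the loopless \<open>K\<^sub>b\<close> together with \<open>M\<close>, which is \<open>K\<^sub>b\<close> plus an isolated vertex. Among the loopless
  digraphs on \<open>b + 1\<close> vertices, those strictly above \<open>M\<close> are exactly the ones in which the further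
  vertex is attached to \<open>K\<^sub>b\<close>; with loops admitted, a loop at the isolated vertex would also go
  strictly above \<open>M\<close>.\<close>

section \<open>Finite digraphs\<close>

definition loopfree :: "'a pair_pre_digraph \<Rightarrow> bool" where
  "loopfree G \<longleftrightarrow> (\<forall>v. (v, v) \<notin> parcs G)"

text \<open>The flag \<open>loops\<close> treats the class of all digraphs and the class of loopless digraphs
  uniformly: a full digraph is one to which no arc can be added within the class.\<close>

definition full :: "bool \<Rightarrow> 'a pair_pre_digraph \<Rightarrow> bool" where
  "full loops G \<longleftrightarrow> parcs G = {(u, v). u \<in> pverts G \<and> v \<in> pverts G \<and> (loops \<or> u \<noteq> v)}"

definition full_on :: "bool \<Rightarrow> 'a set \<Rightarrow> 'a pair_pre_digraph" where
  "full_on loops V = \<lparr>pverts = V, parcs = {(u, v). u \<in> V \<and> v \<in> V \<and> (loops \<or> u \<noteq> v)}\<rparr>"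

definition add_vertex :: "'a \<Rightarrow> 'a pair_pre_digraph \<Rightarrow> 'a pair_pre_digraph" where
  "add_vertex v G = \<lparr>pverts = insert v (pverts G), parcs = parcs G\<rparr>"

lemma add_vertex_simps [simp]:
  "pverts (add_vertex v G) = insert v (pverts G)" "parcs (add_vertex v G) = parcs G"
  by (simp_all add: add_vertex_def)

lemma full_on_simps [simp]:
  "pverts (full_on loops V) = V"
  "parcs (full_on loops V) = {(u, v). u \<in> V \<and> v \<in> V \<and> (loops \<or> u \<noteq> v)}"
  by (simp_all add: full_on_def)

lemma finite_digraph_iff:
  "finite_digraph G \<longleftrightarrow>
     finite (pverts G) \<and> pverts G \<noteq> {} \<and> parcs G \<subseteq> pverts G \<times> pverts G"
proof
  assume "finite_digraph G"
  then interpret pair_fin_digraph G by (simp add: finite_digraph_def)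
  show "finite (pverts G) \<and> pverts G \<noteq> {} \<and> parcs G \<subseteq> pverts G \<times> pverts G"
    using \<open>finite_digraph G\<close> in_arcsD1 in_arcsD2 by (auto simp: finite_digraph_def)
next
  assume *: "finite (pverts G) \<and> pverts G \<noteq> {} \<and> parcs G \<subseteq> pverts G \<times> pverts G"
  then have "finite (parcs G)" by (meson finite_SigmaI finite_subset)
  with * show "finite_digraph G"
    unfolding finite_digraph_def by (auto intro!: pair_fin_digraph.intro
      pair_wf_digraph.intro pair_fin_digraph_axioms.intro)
qed

lemma finite_parcs: "finite_digraph G \<Longrightarrow> finite (parcs G)"
  unfolding finite_digraph_iff by (meson finite_SigmaI finite_subset)

lemma full_full_on [simp]: "full loops (full_on loops V)"
  by (simp add: full_def)

lemma finite_digraph_full_on: "finite V \<Longrightarrow> V \<noteq> {} \<Longrightarrow> finite_digraph (full_on loops V)"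
  by (auto simp: finite_digraph_iff)

lemma finite_digraph_add_vertex: "finite_digraph G \<Longrightarrow> finite_digraph (add_vertex v G)"
  by (auto simp: finite_digraph_iff)

lemma embeds_identity:
  assumes "pverts G \<subseteq> pverts H" "parcs G \<subseteq> parcs H"
  shows "embeds G H"
  unfolding embeds_def inj_hom_def using assms by (intro exI[of _ id]) auto

lemma embeds_card_verts:
  assumes "embeds G H" "finite_digraph H"
  shows "card (pverts G) \<le> card (pverts H)"
  using assms card_inj_on_le unfolding embeds_def inj_hom_def finite_digraph_iff by blast

lemma inj_on_arcs:
  assumes "inj_hom f G H" "finite_digraph G"
  shows "inj_on (map_prod f f) (parcs G)" "map_prod f f ` parcs G \<subseteq> parcs H"
  using assms map_prod_inj_on[of f "pverts G" f "pverts G"]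
  unfolding inj_hom_def finite_digraph_iff by (auto intro: inj_on_subset)

lemma embeds_card_arcs:
  assumes "embeds G H" "finite_digraph G" "finite_digraph H"
  shows "card (parcs G) \<le> card (parcs H)"
  using assms inj_on_arcs card_inj_on_le finite_parcs unfolding embeds_def by meson

text \<open>An embedding that misses neither a vertex nor an arc is an isomorphism, so
  strictness can be tested by counting.\<close>

lemma embeds_converse_if_card_le:
  assumes "embeds G H" "finite_digraph G" "finite_digraph H"
    and "card (pverts H) \<le> card (pverts G)" "card (parcs H) \<le> card (parcs G)"
  shows "embeds H G"
proof -
  obtain f where f: "inj_hom f G H" using assms(1) by (auto simp: embeds_def)
  have inj: "inj_on f (pverts G)" using f by (simp add: inj_hom_def)
  have V: "f ` pverts G = pverts H"
    using f assms(3,4) card_image[OF inj] unfolding inj_hom_def finite_digraph_iff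
    by (intro card_seteq) auto
  have A: "map_prod f f ` parcs G = parcs H"
    using assms(5) card_image[OF inj_on_arcs(1)[OF f assms(2)]] inj_on_arcs(2)[OF f assms(2)]
      finite_parcs[OF assms(3)] by (intro card_seteq) auto
  have "inj_hom (the_inv_into (pverts G) f) H G"
    unfolding inj_hom_def
  proof (intro conjI allI impI)
    show "the_inv_into (pverts G) f ` pverts H \<subseteq> pverts G"
      using V the_inv_into_into[OF inj] by blast
    show "inj_on (the_inv_into (pverts G) f) (pverts H)"
      using V inj_on_the_inv_into[OF inj] by simp
    fix u v assume "(u, v) \<in> parcs H"
    then obtain x y where xy: "(x, y) \<in> parcs G" "u = f x" "v = f y" using A by force
    then have "x \<in> pverts G" "y \<in> pverts G" using assms(2) by (auto simp: finite_digraph_iff)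
    then show "(the_inv_into (pverts G) f u, the_inv_into (pverts G) f v) \<in> parcs G"
      using xy inj by (simp add: the_inv_into_f_f)
  qed
  then show ?thesis by (auto simp: embeds_def)
qed

lemma embeds_full_iff:
  assumes "finite_digraph G" "finite_digraph K" "full loops K" "loops \<or> loopfree G"
  shows "embeds G K \<longleftrightarrow> card (pverts G) \<le> card (pverts K)"
proof
  assume "card (pverts G) \<le> card (pverts K)"
  then obtain f where f: "f ` pverts G \<subseteq> pverts K" "inj_on f (pverts G)"
    using assms(1,2) card_le_inj[of "pverts G" "pverts K"] by (auto simp: finite_digraph_iff)
  have "(f u, f v) \<in> parcs K" if uv: "(u, v) \<in> parcs G" for u v
  proof -
    have V: "u \<in> pverts G" "v \<in> pverts G" using uv assms(1) by (auto simp: finite_digraph_iff)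
    moreover have "f u \<noteq> f v" if "\<not> loops"
      using that uv assms(4) inj_onD[OF f(2) _ V] by (auto simp: loopfree_def)
    ultimately show ?thesis using assms(3) f(1) by (auto simp: full_def)
  qed
  then show "embeds G K" using f unfolding embeds_def inj_hom_def by blast
qed (use assms(2) embeds_card_verts in blast)

section \<open>Order-theoretic notions\<close>

definition least_above :: "('a::order \<Rightarrow> bool) \<Rightarrow> 'a \<Rightarrow> 'a \<Rightarrow> bool" where
  "least_above P k m \<longleftrightarrow> P m \<and> k < m \<and> (\<forall>z. P z \<and> k < z \<longrightarrow> m \<le> z)"

definition complete_elt :: "'a::order \<Rightarrow> bool" where
  "complete_elt k \<longleftrightarrow> (\<exists>m. least_above (\<lambda>_. True) k m)"

text \<open>The least complete element is the single loop.\<close>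

definition loopless :: "'a::order \<Rightarrow> bool" where
  "loopless x \<longleftrightarrow> \<not> (\<exists>k. k \<le> x \<and> complete_elt k)"

text \<open>Complete elements measure size: \<open>no_larger y x\<close> says that \<open>y\<close> has at most as many vertices
  as \<open>x\<close>.\<close>

definition no_larger :: "'a::order \<Rightarrow> 'a \<Rightarrow> bool" where
  "no_larger y x \<longleftrightarrow> (\<forall>k. complete_elt k \<and> x \<le> k \<longrightarrow> y \<le> k)"

text \<open>Here \<open>k\<close> stands for a loopless complete digraph, \<open>m\<close> for \<open>k\<close> with an isolated vertex, and
  \<open>x\<close> ranges over the ways to attach that vertex to \<open>k\<close>. The condition \<open>m \<le> h\<close> also makes the copy
  of \<open>k\<close> in \<open>h\<close> a proper part of \<open>h\<close>.\<close>

definition separable :: "'a::order \<Rightarrow> bool" where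
  "separable g \<longleftrightarrow> (\<exists>h k m. g \<le> h \<and> no_larger h g \<and> least_above loopless k m \<and> m \<le> h \<and>
     (\<forall>x. loopless x \<and> m < x \<and> no_larger x m \<longrightarrow> \<not> x \<le> h))"

section \<open>The meaning of these notions for digraph types\<close>

abbreviation type_of :: "nat pair_pre_digraph \<Rightarrow> digraph_type" where
  "type_of \<equiv> abs_digraph_type"

lemma type_of_le [simp]:
  assumes "finite_digraph G" "finite_digraph H"
  shows "type_of G \<le> type_of H \<longleftrightarrow> embeds G H"
  using assms by (simp add: less_eq_digraph_type.abs_eq fin_iso_refl)

lemma type_of_less:
  assumes "finite_digraph G" "finite_digraph H"
  shows "type_of G < type_of H \<longleftrightarrow> embeds G H \<and> \<not> embeds H G"
  using assms by (simp add: less_digraph_type_def)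

lemma type_of_cases:
  obtains G where "finite_digraph G" "a = type_of G"
  by (metis Quotient3_abs_rep Quotient3_digraph_type Quotient3_rep_reflp fin_iso_def)

lemma all_types_iff: "(\<forall>a. P a) \<longleftrightarrow> (\<forall>G. finite_digraph G \<longrightarrow> P (type_of G))"
  by (metis type_of_cases)

lemma ex_types_iff: "(\<exists>a. P a) \<longleftrightarrow> (\<exists>G. finite_digraph G \<and> P (type_of G))"
  by (metis type_of_cases)

text \<open>If an arc \<open>(a, b)\<close> can be added, then \<open>G\<close> with that arc and \<open>G\<close> with a further vertex both
  lie strictly above \<open>G\<close>. A common lower bound has no more vertices than the former and no more
  arcs than the latter, hence no more of either than \<open>G\<close>, and cannot lie strictly above \<open>G\<close>.\<close>

lemma least_above_imp_full:
  assumes P: "\<And>F. finite_digraph F \<Longrightarrow> P (type_of F) \<longleftrightarrow> loops \<or> loopfree F"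
    and G: "finite_digraph G" "loops \<or> loopfree G" and v: "v \<notin> pverts G"
    and least: "least_above P (type_of G) m"
  shows "full loops G"
proof (rule ccontr)
  assume "\<not> full loops G"
  moreover have "parcs G \<subseteq> {(u, v). u \<in> pverts G \<and> v \<in> pverts G \<and> (loops \<or> u \<noteq> v)}"
    using G by (auto simp: finite_digraph_iff loopfree_def)
  ultimately obtain a b where ab: "a \<in> pverts G" "b \<in> pverts G" "loops \<or> a \<noteq> b" "(a, b) \<notin> parcs G"
    by (auto simp: full_def)
  define G1 where "G1 = \<lparr>pverts = pverts G, parcs = insert (a, b) (parcs G)\<rparr>"
  define G2 where "G2 = add_vertex v G"
  obtain M where M: "finite_digraph M" "m = type_of M" by (rule type_of_cases)
  have fin: "finite_digraph G1" "finite_digraph G2"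
    using G ab by (auto simp: finite_digraph_iff G1_def G2_def)
  have ok: "P (type_of G1)" "P (type_of G2)"
    using G ab P fin by (auto simp: loopfree_def G1_def G2_def)
  have "\<not> embeds G1 G"
    using embeds_card_arcs[of G1 G] fin G finite_parcs[OF G(1)] ab by (auto simp: G1_def)
  moreover have "\<not> embeds G2 G"
    using embeds_card_verts[of G2 G] G v by (auto simp: G2_def finite_digraph_iff)
  moreover have "embeds G G1" "embeds G G2"
    by (auto intro!: embeds_identity simp: G1_def G2_def)
  ultimately have "embeds M G1" "embeds M G2"
    using least ok fin G M by (auto simp: least_above_def type_of_less)
  then have "card (pverts M) \<le> card (pverts G)" "card (parcs M) \<le> card (parcs G)"
    using embeds_card_verts[of M G1] embeds_card_arcs[of M G2] fin M by (auto simp: G1_def G2_def)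
  moreover have "embeds G M" "\<not> embeds M G"
    using least M G by (auto simp: least_above_def type_of_less)
  ultimately show False using embeds_converse_if_card_le[of G M] G M by blast
qed

text \<open>Something strictly above a full digraph must have more vertices, so an embedding leaves room
  for an isolated vertex.\<close>

lemma least_above_full:
  assumes P: "\<And>F. finite_digraph F \<Longrightarrow> P (type_of F) \<longleftrightarrow> loops \<or> loopfree F"
    and G: "finite_digraph G" "full loops G" and v: "v \<notin> pverts G"
  shows "least_above P (type_of G) (type_of (add_vertex v G))"
  unfolding least_above_def
proof (intro conjI allI impI)
  have fin: "finite_digraph (add_vertex v G)" by (rule finite_digraph_add_vertex[OF G(1)])
  show "P (type_of (add_vertex v G))" using G P[OF fin] by (auto simp: loopfree_def full_def)
  have "\<not> embeds (add_vertex v G) G"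
    using embeds_card_verts[of "add_vertex v G" G] G v by (auto simp: finite_digraph_iff)
  moreover have "embeds G (add_vertex v G)" by (rule embeds_identity) auto
  ultimately show "type_of G < type_of (add_vertex v G)" using G fin by (simp add: type_of_less)
  fix z assume z: "P z \<and> type_of G < z"
  obtain Z where Z: "finite_digraph Z" "z = type_of Z" by (rule type_of_cases)
  have GZ: "embeds G Z" "\<not> embeds Z G" "loops \<or> loopfree Z"
    using z Z G P by (auto simp: type_of_less)
  then obtain f where f: "inj_hom f G Z" by (auto simp: embeds_def)
  have "\<not> card (pverts Z) \<le> card (pverts G)"
    using GZ embeds_full_iff[of Z G loops] Z G by blast
  then have "f ` pverts G \<noteq> pverts Z"
    using f by (metis inj_hom_def card_image order_refl)
  then obtain w where w: "w \<in> pverts Z" "w \<notin> f ` pverts G" using f by (auto simp: inj_hom_def)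
  have "inj_hom (f(v := w)) (add_vertex v G) Z"
    unfolding inj_hom_def
  proof (intro conjI allI impI)
    show "(f(v := w)) ` pverts (add_vertex v G) \<subseteq> pverts Z"
      using f w v by (auto simp: inj_hom_def)
    show "inj_on (f(v := w)) (pverts (add_vertex v G))"
      using f w v by (auto simp: inj_hom_def inj_on_def)
    fix x y assume "(x, y) \<in> parcs (add_vertex v G)"
    moreover from this have "x \<noteq> v" "y \<noteq> v" using v G by (auto simp: finite_digraph_iff)
    ultimately show "((f(v := w)) x, (f(v := w)) y) \<in> parcs Z" using f by (auto simp: inj_hom_def)
  qed
  then show "type_of (add_vertex v G) \<le> z" using Z fin by (auto simp: embeds_def)
qed

lemma fresh_vertex:
  assumes "finite_digraph (G :: nat pair_pre_digraph)"
  obtains v where "v \<notin> pverts G"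
  using assms ex_new_if_finite[OF infinite_UNIV_nat] by (auto simp: finite_digraph_iff)

lemma complete_elt_type_of:
  assumes "finite_digraph G"
  shows "complete_elt (type_of G) \<longleftrightarrow> full True G"
proof -
  obtain v where "v \<notin> pverts G" using assms by (rule fresh_vertex)
  then show ?thesis
    using least_above_imp_full[of "\<lambda>_. True" True G v] least_above_full[of "\<lambda>_. True" True G v] assms
    unfolding complete_elt_def by blast
qed

lemma loopless_type_of:
  assumes "finite_digraph G"
  shows "loopless (type_of G) \<longleftrightarrow> loopfree G"
proof
  assume *: "loopless (type_of G)"
  show "loopfree G"
    unfolding loopfree_def
  proof (rule allI, rule notI)
    fix v assume v: "(v, v) \<in> parcs G"
    let ?L = "full_on True {v}"
    have L: "finite_digraph ?L" by (simp add: finite_digraph_full_on)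
    have "embeds ?L G" using v assms by (intro embeds_identity) (auto simp: finite_digraph_iff)
    then have "type_of ?L \<le> type_of G" using assms L by simp
    with * L show False unfolding loopless_def by (auto simp: complete_elt_type_of)
  qed
next
  assume *: "loopfree G"
  have "\<not> embeds K G" if "finite_digraph K" "full True K" for K :: "nat pair_pre_digraph"
    using that * by (force simp: embeds_def inj_hom_def full_def loopfree_def finite_digraph_iff)
  then show "loopless (type_of G)"
    unfolding loopless_def using assms by (auto simp: ex_types_iff complete_elt_type_of)
qed

text \<open>The test element for the forward direction is the complete digraph with loops on the
  vertices of \<open>G\<close> itself.\<close>

lemma no_larger_type_of:
  assumes "finite_digraph H" "finite_digraph G"
  shows "no_larger (type_of H) (type_of G) \<longleftrightarrow> card (pverts H) \<le> card (pverts G)"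
proof
  let ?K = "full_on True (pverts G)"
  assume *: "no_larger (type_of H) (type_of G)"
  have K: "finite_digraph ?K" using assms by (simp add: finite_digraph_full_on finite_digraph_iff)
  have "embeds G ?K" using assms by (intro embeds_identity) (auto simp: finite_digraph_iff)
  then have "type_of H \<le> type_of ?K"
    using *[unfolded no_larger_def, rule_format, of "type_of ?K"] K assms
    by (simp add: complete_elt_type_of)
  then show "card (pverts H) \<le> card (pverts G)"
    using embeds_card_verts[of H ?K] K assms by simp
next
  assume le: "card (pverts H) \<le> card (pverts G)"
  have "embeds H K" if K: "finite_digraph K" "full True K" "embeds G K" for K :: "nat pair_pre_digraph"
    using le embeds_card_verts[OF K(3,1)] embeds_full_iff[OF assms(1) K(1,2)] by simp
  then show "no_larger (type_of H) (type_of G)"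
    unfolding no_larger_def all_types_iff using assms by (simp add: complete_elt_type_of)
qed

section \<open>Separability and weak connectedness\<close>

lemma weakly_connectedD:
  assumes "weakly_connected G" "S \<subseteq> pverts G" "S \<noteq> {}"
    and "\<And>u v. (u, v) \<in> parcs G \<Longrightarrow> u \<in> S \<longleftrightarrow> v \<in> S"
  shows "S = pverts G"
proof (rule ccontr)
  assume "S \<noteq> pverts G"
  then have "pverts G - S \<noteq> {}" using assms(2) by blast
  moreover have "\<forall>(u, v)\<in>parcs G. (u \<in> S \<and> v \<in> S) \<or> (u \<notin> S \<and> v \<notin> S)" using assms(4) by blast
  ultimately show False using assms(1-3) unfolding weakly_connected_def by blast
qed

text \<open>Of a separating set and its complement, \<open>S\<close> is chosen to be the larger one.\<close>

lemma not_weakly_connectedE: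
  assumes "finite_digraph G" "\<not> weakly_connected G"
  obtains S where "S \<subseteq> pverts G" "S \<noteq> {}" "pverts G - S \<noteq> {}"
    "card (pverts G - S) \<le> card S"
    "parcs G \<subseteq> S \<times> S \<union> (pverts G - S) \<times> (pverts G - S)"
proof -
  obtain S where S: "S \<subseteq> pverts G" "S \<noteq> {}" "pverts G - S \<noteq> {}"
    "\<forall>(u, v)\<in>parcs G. (u \<in> S \<and> v \<in> S) \<or> (u \<notin> S \<and> v \<notin> S)"
    using assms(2) unfolding weakly_connected_def by blast
  have A: "parcs G \<subseteq> S \<times> S \<union> (pverts G - S) \<times> (pverts G - S)"
    using S(4) assms(1) by (force simp: finite_digraph_iff)
  show ?thesis
  proof (cases "card (pverts G - S) \<le> card S")
    case True with S A that show ?thesis by blast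
  next
    case False
    moreover have "pverts G - (pverts G - S) = S" using S(1) by blast
    ultimately show ?thesis using S A that[of "pverts G - S"] by (simp add: Un_commute)
  qed
qed

lemma separable_type_of:
  fixes G :: "nat pair_pre_digraph"
  assumes "finite_digraph G"
  shows "separable (type_of G) \<longleftrightarrow>
    (\<exists>H :: nat pair_pre_digraph. finite_digraph H \<and>
    (\<exists>K :: nat pair_pre_digraph. finite_digraph K \<and>
    (\<exists>M :: nat pair_pre_digraph. finite_digraph M \<and>
       embeds G H \<and> card (pverts H) \<le> card (pverts G) \<and>
       least_above loopless (type_of K) (type_of M) \<and> embeds M H \<and>
       (\<forall>X :: nat pair_pre_digraph. finite_digraph X \<longrightarrow>
          loopfree X \<and> (embeds M X \<and> \<not> embeds X M) \<and> card (pverts X) \<le> card (pverts M) \<longrightarrow>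
          \<not> embeds X H))))"
  unfolding separable_def ex_types_iff all_types_iff using assms
  by (simp add: loopless_type_of no_larger_type_of type_of_less cong: conj_cong)

text \<open>With \<open>S\<close> the larger part, \<open>H\<close> consists of the full digraphs on \<open>S\<close> and on its complement
  \<open>T\<close>. A loopless \<open>X\<close> strictly above \<open>M\<close> and of the same size has an arc that joins the vertex \<open>t\<close>
  to the copy of \<open>K\<close>, so its image in \<open>H\<close> lies on one side; but it has \<open>card S + 1\<close> vertices, more
  than either side.\<close>

lemma separable_if_not_connected:
  assumes G: "finite_digraph G" and dis: "\<not> weakly_connected G"
  shows "separable (type_of G)"
proof -
  obtain S where S: "S \<subseteq> pverts G" "S \<noteq> {}" "pverts G - S \<noteq> {}"
    "card (pverts G - S) \<le> card S" "parcs G \<subseteq> S \<times> S \<union> (pverts G - S) \<times> (pverts G - S)"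
    using G dis by (rule not_weakly_connectedE)
  define T where "T = pverts G - S"
  obtain t where t: "t \<in> T" using S(3) by (auto simp: T_def)
  define H where "H = \<lparr>pverts = pverts G, parcs = S \<times> S \<union> T \<times> T\<rparr>"
  define K where "K = full_on False S"
  define M where "M = add_vertex t K"
  have finS: "finite S" "finite T" using G S(1) by (auto simp: finite_digraph_iff T_def intro: finite_subset)
  have tS: "t \<notin> S" using t by (auto simp: T_def)
  have H: "finite_digraph H" using G S(1) by (auto simp: H_def T_def finite_digraph_iff)
  have K: "finite_digraph K" using S(2) finS by (simp add: K_def finite_digraph_full_on)
  then have M: "finite_digraph M" by (simp add: M_def finite_digraph_add_vertex)
  have cardM: "card (pverts M) = Suc (card S)" using tS finS by (simp add: M_def K_def)
  have GH: "embeds G H" using S(5) by (intro embeds_identity) (auto simp: H_def T_def)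
  have MH: "embeds M H"
    using S(1) t by (intro embeds_identity) (auto simp: H_def M_def K_def T_def)
  have least: "least_above loopless (type_of K) (type_of M)"
    unfolding M_def using tS K
    by (intro least_above_full[of _ False]) (auto simp: loopless_type_of K_def)
  have no: "\<not> embeds X H"
    if X: "finite_digraph X" "loopfree X" "embeds M X" "\<not> embeds X M"
      "card (pverts X) \<le> card (pverts M)" for X :: "nat pair_pre_digraph"
  proof
    assume "embeds X H"
    then obtain h where h: "inj_hom h X H" by (auto simp: embeds_def)
    obtain g where g: "inj_hom g M X" using X(3) by (auto simp: embeds_def)
    \<comment> \<open>\<open>X\<close> has the vertices of \<open>M\<close> but strictly more arcs, so some arc of \<open>X\<close> does not come from \<open>M\<close>.\<close>
    have "\<not> card (parcs X) \<le> card (parcs M)"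
      using embeds_converse_if_card_le[OF X(3) M X(1,5)] X(4) by blast
    moreover have "g ` pverts M = pverts X"
      using g X(1,5) card_image[of g "pverts M"]
      by (intro card_seteq) (auto simp: inj_hom_def finite_digraph_iff)
    moreover have "card (map_prod g g ` parcs M) = card (parcs M)"
      using inj_on_arcs(1)[OF g M] by (rule card_image)
    ultimately have "\<not> parcs X \<subseteq> map_prod g g ` parcs M"
      using card_mono[of "map_prod g g ` parcs M" "parcs X"] finite_parcs[OF M] by auto
    then obtain x y where xy: "(x, y) \<in> parcs X" "(x, y) \<notin> map_prod g g ` parcs M" by auto
    then have "x \<in> g ` pverts M" "y \<in> g ` pverts M"
      using X(1) \<open>g ` pverts M = pverts X\<close> by (auto simp: finite_digraph_iff)
    then obtain p q where pq: "p \<in> pverts M" "q \<in> pverts M" "x = g p" "y = g q" by auto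
    have "p \<noteq> q" using xy(1) pq X(2) by (auto simp: loopfree_def)
    moreover have "(p, q) \<notin> parcs M" using xy(2) pq by force
    ultimately obtain s where s: "s \<in> S" "(p = s \<and> q = t) \<or> (p = t \<and> q = s)"
      using pq(1,2) by (auto simp: M_def K_def)
    \<comment> \<open>All of \<open>M\<close> is mapped to one side of \<open>H\<close>: \<open>S\<close> through the arcs of \<open>K\<close>, and \<open>t\<close> through the
      new arc between \<open>t\<close> and \<open>s\<close>.\<close>
    let ?e = "\<lambda>u. h (g u)"
    have side: "?e u \<in> S \<longleftrightarrow> ?e w \<in> S" if "(g u, g w) \<in> parcs X" for u w
    proof -
      have "(?e u, ?e w) \<in> parcs H" using h that by (auto simp: inj_hom_def)
      then show ?thesis by (auto simp: H_def T_def)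
    qed
    have "?e u \<in> S \<longleftrightarrow> ?e s \<in> S" if "u \<in> pverts M" for u
    proof (cases "u = t")
      case True
      then show ?thesis using side[of p q] xy(1) pq s by auto
    next
      case False
      then have "u = s \<or> (u, s) \<in> parcs M" using that s by (auto simp: M_def K_def)
      then show ?thesis using g side[of u s] by (auto simp: inj_hom_def)
    qed
    moreover have "?e ` pverts M \<subseteq> S \<union> T"
      using inj_hom_comp[OF g h] S(1) by (auto simp: inj_hom_def H_def T_def)
    ultimately have "?e ` pverts M \<subseteq> S \<or> ?e ` pverts M \<subseteq> T" by (auto simp: T_def)
    moreover have "card (?e ` pverts M) = Suc (card S)"
      using inj_hom_comp[OF g h] cardM card_image[of ?e "pverts M"]
      by (simp add: inj_hom_def o_def)
    ultimately show False
      using card_mono[OF finS(1)] card_mono[OF finS(2)] S(4)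
      by (metis T_def Suc_n_not_le_n order_trans)
  qed
  have "card (pverts H) \<le> card (pverts G)" by (simp add: H_def)
  then show ?thesis
    unfolding separable_type_of[OF G] using H K M GH MH least no
    by (intro exI[of _ H] exI[of _ K] exI[of _ M] conjI) simp_all
qed

text \<open>A copy \<open>S\<close> of \<open>K\<close> in \<open>H\<close> is a union of weak components: an arc between \<open>S\<close> and a vertex \<open>z\<close>
  outside would give, together with \<open>K\<close>, one of the forbidden digraphs \<open>X\<close>. Since \<open>G\<close> embeds into
  \<open>H\<close> bijectively on vertices, \<open>S\<close> pulls back to a separating set of \<open>G\<close>.\<close>

lemma not_connected_if_separable:
  assumes G: "finite_digraph G" and sep: "separable (type_of G)"
  shows "\<not> weakly_connected G"
proof
  assume con: "weakly_connected G"
  obtain H K M :: "nat pair_pre_digraph" where fin: "finite_digraph H" "finite_digraph K" "finite_digraph M"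
    and GH: "embeds G H" and small: "card (pverts H) \<le> card (pverts G)"
    and least: "least_above loopless (type_of K) (type_of M)" and MH: "embeds M H"
    and no: "\<forall>X :: nat pair_pre_digraph. finite_digraph X \<longrightarrow>
          loopfree X \<and> (embeds M X \<and> \<not> embeds X M) \<and> card (pverts X) \<le> card (pverts M) \<longrightarrow>
          \<not> embeds X H"
    using sep unfolding separable_type_of[OF G] by blast
  obtain v where v: "v \<notin> pverts K" using fin(2) by (rule fresh_vertex)
  \<comment> \<open>\<open>M\<close> is only known through the order; \<open>N\<close> is a concrete representative of its type.\<close>
  define N where "N = add_vertex v K"
  have N: "finite_digraph N" using fin(2) by (simp add: N_def finite_digraph_add_vertex)
  have "loopfree M" "embeds K M"
    using least fin by (auto simp: least_above_def loopless_type_of type_of_less)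
  then have lfK: "loopfree K" unfolding loopfree_def embeds_def inj_hom_def by blast
  have full: "full False K"
    using least_above_imp_full[of loopless False K v "type_of M"] fin lfK v least loopless_type_of by auto
  then have leastN: "least_above loopless (type_of K) (type_of N)"
    unfolding N_def using fin(2) v by (intro least_above_full[of _ False]) (auto simp: loopless_type_of)
  have MN: "embeds M N" "embeds N M"
    using least leastN fin N unfolding least_above_def by (metis type_of_le)+
  obtain f where f: "inj_hom f N H" using MN(2) MH embeds_trans unfolding embeds_def by metis
  define S where "S = f ` pverts K"
  have injf: "inj_on f (insert v (pverts K))" and arcf: "\<And>x y. (x, y) \<in> parcs K \<Longrightarrow> (f x, f y) \<in> parcs H"
    and Vf: "f ` insert v (pverts K) \<subseteq> pverts H"
    using f by (auto simp: inj_hom_def N_def)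
  have finK: "finite (pverts K)" "pverts K \<noteq> {}" "parcs K \<subseteq> pverts K \<times> pverts K"
    using fin(2) by (auto simp: finite_digraph_iff)
  have closed: "x \<in> S \<longleftrightarrow> y \<in> S" if xy: "(x, y) \<in> parcs H" for x y
  proof (rule ccontr)
    assume *: "\<not> (x \<in> S \<longleftrightarrow> y \<in> S)"
    define z where "z = (if x \<in> S then y else x)"
    have z: "z \<notin> S" "z \<in> pverts H" using * xy fin(1) by (auto simp: z_def finite_digraph_iff)
    define X where "X = \<lparr>pverts = insert z S, parcs = insert (x, y) (map_prod f f ` parcs K)\<rparr>"
    have X: "finite_digraph X" using finK * by (auto simp: X_def finite_digraph_iff S_def z_def)
    have neq: "f a \<noteq> f b" if "(a, b) \<in> parcs K" for a b
      using that injf finK(3) lfK by (auto simp: loopfree_def dest: inj_onD)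
    have lfX: "loopfree X"
      using * neq unfolding loopfree_def X_def by force
    have cK: "card (pverts X) = card (pverts N)"
      using z v finK injf by (auto simp: X_def N_def S_def card_image)
    have "inj_hom (f(v := z)) N X"
      unfolding inj_hom_def
    proof (intro conjI allI impI)
      show "(f(v := z)) ` pverts N \<subseteq> pverts X" by (auto simp: N_def X_def S_def)
      show "inj_on (f(v := z)) (pverts N)"
        using injf z v by (auto simp: N_def S_def inj_on_def)
      fix a b assume ab: "(a, b) \<in> parcs N"
      then have "a \<noteq> v" "b \<noteq> v" using v finK(3) by (auto simp: N_def)
      then show "((f(v := z)) a, (f(v := z)) b) \<in> parcs X" using ab by (force simp: N_def X_def)
    qed
    then have NX: "embeds N X" by (auto simp: embeds_def)
    have "inj_on (map_prod f f) (parcs K)"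
      using inj_on_arcs(1)[OF f N] by (simp add: N_def)
    moreover have "(x, y) \<notin> map_prod f f ` parcs K" using * finK(3) by (auto simp: S_def)
    ultimately have "card (parcs X) = Suc (card (parcs N))"
      using finite_parcs[OF fin(2)] by (simp add: X_def N_def card_image)
    then have "\<not> embeds X N" using embeds_card_arcs[of X N] X N by auto
    then have "\<not> embeds X M" using MN embeds_trans by blast
    moreover have "embeds M X" using MN NX embeds_trans by blast
    moreover have "card (pverts X) \<le> card (pverts M)"
      using cK embeds_card_verts[OF MN(2) fin(3)] by simp
    moreover have "embeds X H"
      using z xy Vf arcf by (intro embeds_identity) (auto simp: X_def S_def)
    ultimately show False using no X lfX by blast
  qed
  obtain g where g: "inj_hom g G H" using GH by (auto simp: embeds_def)
  have surj: "g ` pverts G = pverts H"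
    using g small card_image[of g "pverts G"] fin(1)
    by (intro card_seteq) (auto simp: inj_hom_def finite_digraph_iff)
  have "{u \<in> pverts G. g u \<in> S} = pverts G"
  proof (rule weakly_connectedD[OF con])
    have "S \<subseteq> pverts H" "S \<noteq> {}" using Vf finK(2) by (auto simp: S_def)
    then show "{u \<in> pverts G. g u \<in> S} \<noteq> {}" using surj by force
    fix a b assume ab: "(a, b) \<in> parcs G"
    then have "a \<in> pverts G" "b \<in> pverts G" using G by (auto simp: finite_digraph_iff)
    moreover have "g a \<in> S \<longleftrightarrow> g b \<in> S" using closed g ab by (auto simp: inj_hom_def)
    ultimately show "a \<in> {u \<in> pverts G. g u \<in> S} \<longleftrightarrow> b \<in> {u \<in> pverts G. g u \<in> S}" by simp
  qed auto
  then have "g ` pverts G \<subseteq> S" by blast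
  then have "pverts H \<subseteq> S" using surj by simp
  moreover have "f v \<in> pverts H" "f v \<notin> S"
    using Vf v injf by (auto simp: S_def inj_on_def)
  ultimately show False by blast
qed

lemma weakly_connected_type_iff: "weakly_connected_type a \<longleftrightarrow> \<not> separable a"
proof -
  obtain G where G: "finite_digraph G" "a = type_of G" by (rule type_of_cases)
  then have "weakly_connected_type a \<longleftrightarrow> weakly_connected G"
    by (simp add: weakly_connected_type.abs_eq fin_iso_refl)
  then show ?thesis
    using G separable_if_not_connected not_connected_if_separable by blast
qed

section \<open>The formula\<close>

definition "Imp \<phi> \<psi> = Neg (Conj \<phi> (Neg \<psi>))"
definition "Forall x \<phi> = Neg (Exists x (Neg \<phi>))"
definition "Less x y = Conj (LessEq x y) (Neg (Equal x y))"

lemma satisfies_macros [simp]: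
  "satisfies s (Imp \<phi> \<psi>) \<longleftrightarrow> (satisfies s \<phi> \<longrightarrow> satisfies s \<psi>)"
  "satisfies s (Forall x \<phi>) \<longleftrightarrow> (\<forall>a. satisfies (s(x := a)) \<phi>)"
  "satisfies s (Less x y) \<longleftrightarrow> s x < s y"
  by (auto simp: Imp_def Forall_def Less_def)

lemma free_vars_macros [simp]:
  "free_vars (Imp \<phi> \<psi>) = free_vars \<phi> \<union> free_vars \<psi>"
  "free_vars (Forall x \<phi>) = free_vars \<phi> - {x}"
  "free_vars (Less x y) = {x, y}"
  by (auto simp: Imp_def Forall_def Less_def)

text \<open>The bound variables decrease from the inner notions to the outer ones, so a notion may be
  applied to any variable below those that it binds without capture.\<close>

definition "complete_elt_fm x = Exists 10 (Conj (Less x 10) (Forall 11 (Imp (Less x 11) (LessEq 10 11))))"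
definition "loopless_fm x = Neg (Exists 8 (Conj (LessEq 8 x) (complete_elt_fm 8)))"
definition "no_larger_fm y x = Forall 7 (Imp (Conj (complete_elt_fm 7) (LessEq x 7)) (LessEq y 7))"
definition "least_loopless_above_fm k m =
  Conj (loopless_fm m) (Conj (Less k m) (Forall 6 (Imp (Conj (loopless_fm 6) (Less k 6)) (LessEq m 6))))"
definition "separable_fm = Exists 1 (Exists 2 (Exists 3 (Conj (LessEq 0 1) (Conj (no_larger_fm 1 0)
  (Conj (least_loopless_above_fm 2 3) (Conj (LessEq 3 1)
  (Forall 4 (Imp (Conj (loopless_fm 4) (Conj (Less 3 4) (no_larger_fm 4 3))) (Neg (LessEq 4 1))))))))))"

lemma satisfies_complete_elt_fm [simp]:
  "x < 10 \<Longrightarrow> satisfies s (complete_elt_fm x) \<longleftrightarrow> complete_elt (s x)"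
  by (simp add: complete_elt_fm_def complete_elt_def least_above_def)

lemma satisfies_loopless_fm [simp]:
  "x < 8 \<Longrightarrow> satisfies s (loopless_fm x) \<longleftrightarrow> loopless (s x)"
  by (simp add: loopless_fm_def loopless_def)

lemma satisfies_no_larger_fm [simp]:
  "x < 7 \<Longrightarrow> y < 7 \<Longrightarrow> satisfies s (no_larger_fm y x) \<longleftrightarrow> no_larger (s y) (s x)"
  by (simp add: no_larger_fm_def no_larger_def)

lemma satisfies_least_loopless_above_fm [simp]:
  "k < 6 \<Longrightarrow> m < 6 \<Longrightarrow>
     satisfies s (least_loopless_above_fm k m) \<longleftrightarrow> least_above loopless (s k) (s m)"
  by (simp add: least_loopless_above_fm_def least_above_def)

lemma satisfies_separable_fm: "satisfies s separable_fm \<longleftrightarrow> separable (s 0)"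
  by (simp add: separable_fm_def separable_def)

lemma free_vars_separable_fm: "free_vars separable_fm \<subseteq> {0}"
  by (auto simp: separable_fm_def no_larger_fm_def least_loopless_above_fm_def loopless_fm_def
      complete_elt_fm_def)

theorem mainTheorem4:
  shows "fo_definable {G :: digraph_type. weakly_connected_type G}"
  unfolding fo_definable_def
proof (intro exI conjI)
  show "free_vars (Neg separable_fm) \<subseteq> {0}" using free_vars_separable_fm by simp
  show "{G :: digraph_type. weakly_connected_type G} = {a. satisfies (\<lambda>_. a) (Neg separable_fm)}"
    by (simp add: satisfies_separable_fm weakly_connected_type_iff)
qed

end
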